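(* Let $E$ be a complex topological vector space and let $\mathcal C\subset E$ be a $\mathbb C$-cone. The gauge $d_{\mathcal C}$ on the cone is symmetric and projective, i.e. for all $x,y\in\mathcal C^*$ and $a\in\mathbb C^*=\mathbb C\setminus\{0\}$: $$d_{\mathcal C}(y,x)=d_{\mathcal C}(x,y)=d_{\mathcal C}(ax,y)=d_{\mathcal C}(x,ay).$$
   Context: $S^*=S\setminus\{0\}$. A $\mathbb C$-cone in $E$ is a closed subset $\mathcal C$ which is $\mathbb C$-invariant ($\mathbb C\,\mathcal C=\mathcal C$), contains at least one complex line, and contains no complex planes (if $x,y$ are linearly independent then $\operatorname{Span}_{\mathbb C}\{x,y\}\not\subset\mathcal C$). Gauge $d_{\mathcal C}:\mathcal C^*\times\mathcal C^*\to[0,+\infty]$: for $x,y\in\mathcal C^*$ put $D(x,y)=\{\lambda\in\widehat{\mathbb C}:(1+\lambda)x+(1-\lambda)y\in\mathcal C\}$, with $\infty\in D(x,y)$ iff $x-y\in\mathcal C$, and let $D^o(x,y)$ be its interior in the Riemann sphere $\widehat{\mathbb C}$. If $x,y$ are co-linear, $d_{\mathcal C}(x,y)=0$. If they are independent and $-1,1$ lie in the same connected component $U$ of $D^o(x,y)$, then $d_{\mathcal C}(x,y)=d_U(-1,1)$, the hyperbolic distance in $U$ (normalized by $ds=2|dz|/(1-|z|^2)$ on the unit disk). Otherwise $d_{\mathcal C}(x,y)=+\infty$. *)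

theory Defs
  imports "HOL-Analysis.Analysis"
begin

section \<open>The Riemann sphere\<close>

datatype riemann_sphere = Fin complex | Infty

text \<open>The topology is that of the one-point compactification of the complex plane.\<close>

instantiation riemann_sphere :: topological_space
begin

definition open_riemann_sphere :: "riemann_sphere set \<Rightarrow> bool" where
  "open_riemann_sphere S \<longleftrightarrow>
     open (Fin -` S) \<and> (Infty \<in> S \<longrightarrow> compact (Fin -` (- S)))"

instance
proof
  show "open (UNIV :: riemann_sphere set)"
    by (simp add: open_riemann_sphere_def)
next
  fix S T :: "riemann_sphere set"
  assume "open S" "open T"
  then show "open (S \<inter> T)"
    by (auto simp: open_riemann_sphere_def vimage_Un Compl_Int)
next
  fix K :: "riemann_sphere set set"
  assume K: "\<forall>S\<in>K. open S"
  have o: "open (Fin -` \<Union>K)"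
    using K by (auto simp: open_riemann_sphere_def vimage_Union)
  moreover have "compact (Fin -` (- \<Union>K))" if inf: "Infty \<in> \<Union>K"
  proof -
    obtain S where S: "S \<in> K" "Infty \<in> S" using inf by auto
    have "compact (Fin -` (- S))"
      using K S by (auto simp: open_riemann_sphere_def)
    moreover have "closed (Fin -` (- \<Union>K))"
      using o by (simp add: closed_def vimage_Compl)
    moreover have "Fin -` (- \<Union>K) = Fin -` (- S) \<inter> Fin -` (- \<Union>K)"
      using S by auto
    ultimately show ?thesis by (metis compact_Int_closed)
  qed
  ultimately show "open (\<Union>K)"
    by (simp add: open_riemann_sphere_def)
qed

end

text \<open>The two standard affine charts \<open>w\<close> and \<open>1/w\<close>.  The first is only meaningful away from
  \<open>Infty\<close>, the second only away from \<open>Fin 0\<close>.\<close>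

primrec chart0 :: "riemann_sphere \<Rightarrow> complex" where
  "chart0 (Fin w) = w"
| "chart0 Infty = 0"

primrec chart1 :: "riemann_sphere \<Rightarrow> complex" where
  "chart1 (Fin w) = inverse w"
| "chart1 Infty = 0"

text \<open>Holomorphy of a map from an open subset \<open>S\<close> of the plane into the Riemann sphere.  By
  continuity the two sets on which the charts are used are open.\<close>

definition sphere_holomorphic_on :: "(complex \<Rightarrow> riemann_sphere) \<Rightarrow> complex set \<Rightarrow> bool" where
  "sphere_holomorphic_on f S \<longleftrightarrow>
     continuous_on S f \<and>
     (chart0 \<circ> f) holomorphic_on {z \<in> S. f z \<noteq> Infty} \<and>
     (chart1 \<circ> f) holomorphic_on {z \<in> S. f z \<noteq> Fin 0}"


section \<open>Hyperbolic distance\<close>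

text \<open>Length of a path, and the resulting distance, in the unit disk for the metric
  \<open>ds = 2 |dz| / (1 - |z|^2)\<close>.\<close>

definition disk_length :: "(real \<Rightarrow> complex) \<Rightarrow> real" where
  "disk_length \<gamma> =
     integral {0..1} (\<lambda>t. 2 * norm (vector_derivative \<gamma> (at t)) / (1 - (norm (\<gamma> t))\<^sup>2))"

definition disk_dist :: "complex \<Rightarrow> complex \<Rightarrow> ennreal" where
  "disk_dist z w =
     Inf {ennreal (disk_length \<gamma>) | \<gamma>.
            valid_path \<gamma> \<and> path_image \<gamma> \<subseteq> ball 0 1 \<and> pathstart \<gamma> = z \<and> pathfinish \<gamma> = w}"

text \<open>The hyperbolic metric of a hyperbolic domain \<open>U\<close> (connected, open, omitting at least three
  points of the sphere) is the one for which the holomorphic universal covering maps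
  \<open>p\<close> from the unit disk to \<open>U\<close> are local isometries.  Paths in \<open>U\<close> lift to paths in the disk of
  the same length, so the distance in \<open>U\<close> is the infimum of the disk distances between lifts.
  Two such covering maps differ by an automorphism of the disk, which is an isometry; taking the
  infimum over all of them as well merely avoids choosing one.  If there is no such covering map,
  i.e. if \<open>U\<close> is not a hyperbolic domain, then the value is \<open>\<infinity>\<close>.  This does not happen for the
  domains used in the gauge of a cone below: since the cone is closed and contains no complex plane,
  the complement of \<open>D x y\<close> is open and nonempty whenever \<open>x\<close>, \<open>y\<close> are independent.\<close>

definition disk_covering :: "(complex \<Rightarrow> riemann_sphere) \<Rightarrow> riemann_sphere set \<Rightarrow> bool" where
  "disk_covering p U \<longleftrightarrow>
     covering_space (ball 0 1) p U \<and> sphere_holomorphic_on p (ball 0 1)"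

definition hyperbolic_dist ::
    "riemann_sphere set \<Rightarrow> riemann_sphere \<Rightarrow> riemann_sphere \<Rightarrow> ennreal" where
  "hyperbolic_dist U u v =
     Inf {disk_dist z w | p z w.
            disk_covering p U \<and> z \<in> ball 0 1 \<and> w \<in> ball 0 1 \<and> p z = u \<and> p w = v}"


section \<open>Complex cones and their gauge\<close>

text \<open>Continuity of addition and negation is part of the class
  \<^class>\<open>topological_ab_group_add\<close>.  No separation axiom is imposed.\<close>

locale complex_tvs = vector_space scale
  for scale :: "complex \<Rightarrow> 'a::topological_ab_group_add \<Rightarrow> 'a" +
  assumes continuous_scale: "continuous_on UNIV (\<lambda>(c, v). scale c v)"
begin

definition lin_indep :: "'a \<Rightarrow> 'a \<Rightarrow> bool" where
  "lin_indep x y \<longleftrightarrow> x \<noteq> y \<and> independent {x, y}"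

definition complex_cone :: "'a set \<Rightarrow> bool" where
  "complex_cone C \<longleftrightarrow>
     closed C \<and>
     {scale c x | c x. x \<in> C} = C \<and>
     (\<exists>x. x \<noteq> 0 \<and> span {x} \<subseteq> C) \<and>
     (\<forall>x y. lin_indep x y \<longrightarrow> \<not> span {x, y} \<subseteq> C)"

definition D :: "'a set \<Rightarrow> 'a \<Rightarrow> 'a \<Rightarrow> riemann_sphere set" where
  "D C x y =
     Fin ` {l. scale (1 + l) x + scale (1 - l) y \<in> C} \<union> (if x - y \<in> C then {Infty} else {})"

definition cone_gauge :: "'a set \<Rightarrow> 'a \<Rightarrow> 'a \<Rightarrow> ennreal" where
  "cone_gauge C x y =
     (if \<not> lin_indep x y then 0
      else if connected_component (interior (D C x y)) (Fin (-1)) (Fin 1)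
      then hyperbolic_dist (connected_component_set (interior (D C x y)) (Fin (-1)))
             (Fin (-1)) (Fin 1)
      else \<infinity>)"

end

end

theory Submission
  imports Defs
begin

text \<open>Up to a Moebius transformation of the Riemann sphere, the set \<open>D x y\<close> depends neither on the
  order nor on the scale of the two vectors: \<open>\<lambda> \<mapsto> - \<lambda>\<close> maps \<open>D x y\<close> onto \<open>D y x\<close>
  and exchanges \<open>-1\<close> and \<open>1\<close>, while in the coordinate \<open>t = (1 + \<lambda>) / (1 - \<lambda>)\<close> the condition reads
  \<open>t x + y \<in> C\<close>, so that replacing \<open>x\<close> by \<open>a x\<close> amounts to \<open>t \<mapsto> a t\<close>, which fixes the
  points \<open>t = 0\<close> and \<open>t = \<infinity>\<close> corresponding to \<open>-1\<close> and \<open>1\<close>.  Moebius transformations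
  carry holomorphic coverings by the disk to such coverings, hence preserve hyperbolic distances.\<close>

section \<open>Symmetry of the hyperbolic distance\<close>

lemma has_vector_derivative_reversepath:
  fixes g :: "real \<Rightarrow> 'a::real_normed_vector"
  assumes "(g has_vector_derivative d) (at (1 - t))"
  shows "(reversepath g has_vector_derivative - d) (at t)"
proof -
  have "((\<lambda>x. 1 - x) has_vector_derivative -1) (at t)"
    by (auto intro!: derivative_eq_intros)
  from vector_diff_chain_at[OF this] assms
  have "(g \<circ> (\<lambda>x. 1 - x) has_vector_derivative - 1 *\<^sub>R d) (at t)" by simp
  then show ?thesis by (simp add: reversepath_o)
qed

text \<open>Valid paths are only piecewise differentiable. Treating the remaining points as well
  makes the integrands in \<open>disk_length\<close> correspond at every \<open>t\<close>, so that
  no exceptional set has to be removed.\<close>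

lemma norm_vector_derivative_reversepath:
  fixes g :: "real \<Rightarrow> 'a::real_normed_vector"
  shows "norm (vector_derivative (reversepath g) (at t)) = norm (vector_derivative g (at (1 - t)))"
proof (cases "\<exists>d. (g has_vector_derivative d) (at (1 - t))")
  case True
  then obtain d where d: "(g has_vector_derivative d) (at (1 - t))" by blast
  from vector_derivative_at[OF has_vector_derivative_reversepath[OF d]] vector_derivative_at[OF d]
  show ?thesis by simp
next
  case False
  \<comment> \<open>Reversing twice gives back \<open>g\<close>, so a derivative of the reversed
    path at \<open>t\<close> would yield one of \<open>g\<close> at \<open>1 - t\<close>.\<close>
  moreover have "\<nexists>d. (reversepath g has_vector_derivative d) (at t)"
    using False has_vector_derivative_reversepath[of "reversepath g" _ "1 - t"] by auto
  \<comment> \<open>Both sides are then the same junk value \<open>SOME d. False\<close>.\<close>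
  ultimately show ?thesis by (simp add: vector_derivative_def)
qed

lemma disk_length_reversepath: "disk_length (reversepath \<gamma>) = disk_length \<gamma>"
proof -
  define f where "f t = 2 * norm (vector_derivative \<gamma> (at t)) / (1 - (norm (\<gamma> t))\<^sup>2)" for t
  have "disk_length (reversepath \<gamma>) = integral {0..1} (\<lambda>t. f (1 - t))"
    by (simp add: disk_length_def norm_vector_derivative_reversepath f_def)
      (simp add: reversepath_def)
  \<comment> \<open>The substitution of \<open>1 - t\<close> for \<open>t\<close> is split into a
    reflection, which leads to the integral of \<open>f (1 + t)\<close> over \<open>{-1..0}\<close>,
    and a shift by 1.\<close>
  also have "\<dots> = integral {0..1} f"
    using Henstock_Kurzweil_Integration.integral_reflect_real[of 0 "-1" "\<lambda>t. f (1 + t)"]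
      integral_shift_Icc_real[of "-1" 0 f 1]
    by (simp add: o_def)
  finally show ?thesis by (simp add: disk_length_def f_def[abs_def])
qed

text \<open>Reversal turns each path from \<open>w\<close> to \<open>z\<close> into one of equal
  length from \<open>z\<close> to \<open>w\<close>, so the infimum on the left runs over at least as
  many lengths.\<close>

lemma disk_dist_le_commute: "disk_dist z w \<le> disk_dist w z"
  unfolding disk_dist_def
proof (rule Inf_superset_mono, clarify)
  fix \<gamma> assume "valid_path \<gamma>" "path_image \<gamma> \<subseteq> ball 0 1" "w = pathstart \<gamma>" "z = pathfinish \<gamma>"
  then show "\<exists>\<delta>. ennreal (disk_length \<gamma>) = ennreal (disk_length \<delta>) \<and> valid_path \<delta> \<and>
      path_image \<delta> \<subseteq> ball 0 1 \<and> pathstart \<delta> = pathfinish \<gamma> \<and> pathfinish \<delta> = pathstart \<gamma>"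
    by (intro exI[of _ "reversepath \<gamma>"]) (simp add: disk_length_reversepath)
qed

lemma disk_dist_commute: "disk_dist z w = disk_dist w z"
  by (intro antisym disk_dist_le_commute)

lemma hyperbolic_dist_commute: "hyperbolic_dist U u v = hyperbolic_dist U v u"
proof -
  have "hyperbolic_dist U u v \<le> hyperbolic_dist U v u" for u v
    unfolding hyperbolic_dist_def
    by (rule Inf_superset_mono) (auto intro: disk_dist_commute)
  then show ?thesis by (intro antisym)
qed


section \<open>Automorphisms of the Riemann sphere\<close>

primrec affine_map :: "complex \<Rightarrow> complex \<Rightarrow> riemann_sphere \<Rightarrow> riemann_sphere" where
  "affine_map c d (Fin w) = Fin (c * w + d)"
| "affine_map c d Infty = Infty"

primrec inversion :: "riemann_sphere \<Rightarrow> riemann_sphere" where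
  "inversion (Fin w) = (if w = 0 then Infty else Fin (inverse w))"
| "inversion Infty = Fin 0"

text \<open>Since \<open>sphere_holomorphic_on\<close> speaks only of maps from plane sets into the
  sphere, holomorphy of a self-map of the sphere is tested by composition with such maps. Asking the
  same of the inverse makes the notion symmetric in \<open>f\<close> and \<open>g\<close>.\<close>

definition sphere_automorphism :: "(riemann_sphere \<Rightarrow> riemann_sphere) \<Rightarrow> bool" where
  "sphere_automorphism f \<longleftrightarrow>
     (\<exists>g. homeomorphism UNIV UNIV f g \<and>
        (\<forall>p S. open S \<longrightarrow> sphere_holomorphic_on p S \<longrightarrow>
           sphere_holomorphic_on (f \<circ> p) S \<and> sphere_holomorphic_on (g \<circ> p) S))"

lemma sphere_automorphismE:
  assumes "sphere_automorphism f"
  obtains g where "homeomorphism UNIV UNIV f g" "sphere_automorphism g"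
    "\<And>p S. open S \<Longrightarrow> sphere_holomorphic_on p S \<Longrightarrow> sphere_holomorphic_on (f \<circ> p) S"
  using assms unfolding sphere_automorphism_def by (metis homeomorphism_symD)

lemma sphere_automorphism_compose:
  assumes "sphere_automorphism f" "sphere_automorphism g"
  shows "sphere_automorphism (f \<circ> g)"
proof -
  obtain f' where f: "homeomorphism UNIV UNIV f f'"
    "\<And>p S. open S \<Longrightarrow> sphere_holomorphic_on p S \<Longrightarrow>
       sphere_holomorphic_on (f \<circ> p) S \<and> sphere_holomorphic_on (f' \<circ> p) S"
    using assms(1) unfolding sphere_automorphism_def by blast
  obtain g' where g: "homeomorphism UNIV UNIV g g'"
    "\<And>p S. open S \<Longrightarrow> sphere_holomorphic_on p S \<Longrightarrow>
       sphere_holomorphic_on (g \<circ> p) S \<and> sphere_holomorphic_on (g' \<circ> p) S"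
    using assms(2) unfolding sphere_automorphism_def by blast
  have "homeomorphism UNIV UNIV (f \<circ> g) (g' \<circ> f')"
    by (rule homeomorphism_compose[OF g(1) f(1)])
  with f(2) g(2) show ?thesis
    unfolding sphere_automorphism_def by (intro exI[of _ "g' \<circ> f'"]) (auto simp: comp_assoc)
qed

section \<open>Topology of the sphere and continuity of the Moebius generators\<close>

lemma continuous_on_UNIV_sphereI:
  fixes f :: "riemann_sphere \<Rightarrow> riemann_sphere"
  assumes "\<And>V. open V \<Longrightarrow> open (f -` V)"
  shows "continuous_on UNIV f"
  using assms by (simp add: continuous_on_open_vimage)

lemma continuous_on_affine_map:
  assumes "c \<noteq> 0"
  shows "continuous_on UNIV (affine_map c d)"
proof (rule continuous_on_UNIV_sphereI)
  fix V :: "riemann_sphere set" assume V: "open V"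
  have *: "Fin -` (affine_map c d -` V) = (\<lambda>w. c * w + d) -` (Fin -` V)" by auto
  have "open (Fin -` (affine_map c d -` V))"
    unfolding *
    by (rule open_vimage) (use V in \<open>auto simp: open_riemann_sphere_def intro!: continuous_intros\<close>)
  moreover have "compact (Fin -` (- (affine_map c d -` V)))" if "Infty \<in> V"
  proof -
    \<comment> \<open>The set is the image of a compact set under the inverse affine map, hence
      compact.\<close>
    have *: "Fin -` (- (affine_map c d -` V)) = (\<lambda>w. (w - d) / c) ` (Fin -` (- V))"
    proof (intro set_eqI iffI)
      fix w assume "w \<in> Fin -` (- (affine_map c d -` V))"
      then show "w \<in> (\<lambda>w. (w - d) / c) ` (Fin -` (- V))"
        using assms by (intro image_eqI[of _ _ "c * w + d"]) auto
    qed (use assms in auto)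
    have "compact (Fin -` (- V))" using V that by (simp add: open_riemann_sphere_def)
    then show ?thesis unfolding *
      by (intro compact_continuous_image) (use assms in \<open>auto intro!: continuous_intros\<close>)
  qed
  ultimately show "open (affine_map c d -` V)" by (simp add: open_riemann_sphere_def)
qed

text \<open>For closed sets compactness is boundedness, and a bound \<open>B\<close> on
  \<open>K\<close> corresponds to the radius \<open>1/B\<close> for the inverses. This translates
  the compactness condition at \<open>Infty\<close> into one near 0.\<close>

lemma compact_iff_inverse_avoids_ball:
  assumes K: "open (- K)"
  shows "compact K \<longleftrightarrow> (\<exists>e>0. \<forall>w. norm w < e \<longrightarrow> w \<noteq> 0 \<longrightarrow> inverse w \<notin> (K :: complex set))"
proof
  assume "compact K"
  then obtain B where B: "B > 0" "\<And>w. w \<in> K \<Longrightarrow> norm w \<le> B"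
    by (metis bounded_pos compact_imp_bounded)
  show "\<exists>e>0. \<forall>w. norm w < e \<longrightarrow> w \<noteq> 0 \<longrightarrow> inverse w \<notin> K"
  proof (intro exI[of _ "inverse B"] conjI allI impI notI)
    fix w assume w: "norm w < inverse B" "w \<noteq> 0" "inverse w \<in> K"
    then have "inverse (norm w) \<le> B" using B(2) by (metis norm_inverse)
    with w B show False by (simp add: field_simps)
  qed (use B in auto)
next
  assume "\<exists>e>0. \<forall>w. norm w < e \<longrightarrow> w \<noteq> 0 \<longrightarrow> inverse w \<notin> K"
  then obtain e where e: "e > 0" "\<And>w. norm w < e \<Longrightarrow> w \<noteq> 0 \<Longrightarrow> inverse w \<notin> K" by blast
  have "norm w \<le> inverse e" if "w \<in> K" for w
  proof (cases "w = 0")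
    case False
    with e(2)[of "inverse w"] that have "\<not> norm (inverse w) < e" by auto
    with False e(1) show ?thesis by (simp add: norm_divide field_simps)
  qed (use e in auto)
  then have "bounded K" by (auto simp: bounded_iff)
  with K show "compact K" by (simp add: compact_eq_bounded_closed closed_def)
qed

text \<open>The sphere is glued from two planes, embedded by \<open>Fin\<close> and
  \<open>inversion \<circ> Fin\<close>. Inversion merely exchanges the two conditions, which gives
  its continuity.\<close>

lemma open_sphere_iff:
  "open V \<longleftrightarrow> open (Fin -` V) \<and> open ((inversion \<circ> Fin) -` V)"
proof -
  \<comment> \<open>Away from 0 the second embedding is \<open>inverse\<close>, which is continuous
    there. Only the point 0, which represents \<open>Infty\<close>, needs the compactness
    condition.\<close>
  have nz: "open ((inversion \<circ> Fin) -` V - {0})" if "open (Fin -` V)"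
  proof -
    have "(inversion \<circ> Fin) -` V - {0} = inverse -` (Fin -` V) \<inter> - {0}" by auto
    moreover have "continuous_on (- {0}) (inverse :: complex \<Rightarrow> complex)"
      by (auto intro!: continuous_intros)
    ultimately show ?thesis
      using that by (metis open_Compl closed_singleton continuous_on_open_vimage)
  qed
  have "compact (Fin -` (- V)) \<longleftrightarrow> open ((inversion \<circ> Fin) -` V)"
    if o: "open (Fin -` V)" and i: "Infty \<in> V"
  proof -
    have K: "compact (Fin -` (- V)) \<longleftrightarrow>
        (\<exists>e>0. \<forall>w. norm w < e \<longrightarrow> w \<noteq> 0 \<longrightarrow> inverse w \<notin> Fin -` (- V))"
      by (rule compact_iff_inverse_avoids_ball) (use o in \<open>auto simp: vimage_Compl\<close>)
    also have "\<dots> \<longleftrightarrow> (\<exists>e>0. ball 0 e \<subseteq> (inversion \<circ> Fin) -` V)"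
      using i by (auto simp: subset_iff)
    also have "\<dots> \<longleftrightarrow> open ((inversion \<circ> Fin) -` V)"
    proof
      assume "\<exists>e>0. ball 0 e \<subseteq> (inversion \<circ> Fin) -` V"
      then obtain e where e: "e > 0" "ball 0 e \<subseteq> (inversion \<circ> Fin) -` V" by blast
      then have "(inversion \<circ> Fin) -` V = ((inversion \<circ> Fin) -` V - {0}) \<union> ball 0 e"
        by auto
      then show "open ((inversion \<circ> Fin) -` V)" using nz[OF o] by (metis open_Un open_ball)
    next
      assume "open ((inversion \<circ> Fin) -` V)"
      moreover have "0 \<in> (inversion \<circ> Fin) -` V" using i by simp
      ultimately show "\<exists>e>0. ball 0 e \<subseteq> (inversion \<circ> Fin) -` V"
        using open_contains_ball by blast
    qed
    finally show ?thesis .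
  qed
  moreover have "open ((inversion \<circ> Fin) -` V)" if "open (Fin -` V)" "Infty \<notin> V"
  proof -
    have "(inversion \<circ> Fin) -` V = (inversion \<circ> Fin) -` V - {0}" using that by auto
    with nz that show ?thesis by simp
  qed
  ultimately show ?thesis unfolding open_riemann_sphere_def by blast
qed

lemma inversion_inversion [simp]: "inversion (inversion s) = s"
  by (cases s) auto

lemma continuous_on_inversion: "continuous_on UNIV inversion"
proof (rule continuous_on_UNIV_sphereI)
  fix V :: "riemann_sphere set" assume "open V"
  moreover have "(inversion \<circ> Fin) -` (inversion -` V) = Fin -` V"
    by (simp add: vimage_def o_def del: inversion.simps)
  moreover have "Fin -` (inversion -` V) = (inversion \<circ> Fin) -` V"
    by (simp add: vimage_comp)
  ultimately show "open (inversion -` V)"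
    using open_sphere_iff by metis
qed

section \<open>Holomorphy of the Moebius generators\<close>

lemma chart_inversion:
  "chart0 (inversion s) = chart1 s" "chart1 (inversion s) = chart0 s"
  "inversion s = Infty \<longleftrightarrow> s = Fin 0" "inversion s = Fin 0 \<longleftrightarrow> s = Infty"
  \<comment> \<open>The default values \<open>chart0 Infty = 0\<close> and
    \<open>inverse 0 = 0\<close> match, so the chart identities hold even where a chart is
    meaningless.\<close>
  by (cases s; simp)+

lemma sphere_holomorphic_on_inversion:
  assumes "sphere_holomorphic_on p S"
  shows "sphere_holomorphic_on (inversion \<circ> p) S"
proof -
  have "continuous_on S (inversion \<circ> p)"
    using assms continuous_on_inversion unfolding sphere_holomorphic_on_def
    by (meson continuous_on_compose continuous_on_subset subset_UNIV)
  moreover have "chart0 \<circ> (inversion \<circ> p) = chart1 \<circ> p" "chart1 \<circ> (inversion \<circ> p) = chart0 \<circ> p"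
    by (auto simp: chart_inversion)
  ultimately show ?thesis
    using assms by (simp add: sphere_holomorphic_on_def chart_inversion)
qed

lemma sphere_automorphism_inversion: "sphere_automorphism inversion"
  unfolding sphere_automorphism_def
  by (rule exI[of _ inversion])
    (auto simp: homeomorphism_def continuous_on_inversion sphere_holomorphic_on_inversion
      intro!: image_eqI[of _ inversion "inversion _"])

text \<open>This makes the subdomains on which the charts are used open, so that holomorphy can be
  glued along them.\<close>

lemma open_sphere_Compl_singleton: "open (- {s :: riemann_sphere})"
proof (cases s)
  case (Fin w)
  then have "Fin -` (- {s}) = - {w}" "Fin -` {s} = {w}" by auto
  then show ?thesis by (simp add: open_riemann_sphere_def open_Compl Fin)
next
  case Infty
  then have "Fin -` (- {s}) = UNIV" by auto
  then show ?thesis by (simp add: open_riemann_sphere_def Infty)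
qed

lemma sphere_holomorphic_on_affine_map:
  assumes c: "c \<noteq> 0" and S: "open S" and p: "sphere_holomorphic_on p S"
  shows "sphere_holomorphic_on (affine_map c d \<circ> p) S"
proof -
  let ?q = "affine_map c d \<circ> p"
  have cp: "continuous_on S p" and h0: "(chart0 \<circ> p) holomorphic_on {z \<in> S. p z \<noteq> Infty}"
    and h1: "(chart1 \<circ> p) holomorphic_on {z \<in> S. p z \<noteq> Fin 0}"
    using p by (auto simp: sphere_holomorphic_on_def)
  have cq: "continuous_on S ?q"
    using cp continuous_on_affine_map[OF c]
    by (meson continuous_on_compose continuous_on_subset subset_UNIV)
  have op: "open {z \<in> S. f z \<noteq> s}" if "continuous_on S f" for f and s :: riemann_sphere
  proof -
    have "{z \<in> S. f z \<noteq> s} = f -` (- {s}) \<inter> S" by auto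
    then show ?thesis
      using that S open_sphere_Compl_singleton[of s] by (metis continuous_on_open_vimage)
  qed
  have inf: "affine_map c d s = Infty \<longleftrightarrow> s = Infty" for s by (cases s) auto
  \<comment> \<open>The second chart of the image is computed from either chart of \<open>p\<close>:
    with \<open>w = chart0 (p z)\<close> it is \<open>1 / (c w + d)\<close> on \<open>?A\<close>,
    and with \<open>u = chart1 (p z)\<close> it is \<open>u / (c + d u)\<close> on
    \<open>?B\<close>. No point has both \<open>p z = Infty\<close> and \<open>p z = Fin 0\<close>,
    so the two sets cover the required domain.\<close>
  let ?A = "{z \<in> S. p z \<noteq> Infty} \<inter> {z \<in> S. ?q z \<noteq> Fin 0}"
  let ?B = "{z \<in> S. p z \<noteq> Fin 0} \<inter> {z \<in> S. ?q z \<noteq> Fin 0}"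
  have "(chart0 \<circ> ?q) holomorphic_on {z \<in> S. ?q z \<noteq> Infty}"
  proof (rule holomorphic_transform)
    show "(\<lambda>z. c * (chart0 \<circ> p) z + d) holomorphic_on {z \<in> S. ?q z \<noteq> Infty}"
      using h0 by (simp only: o_apply inf) (intro holomorphic_intros, simp add: o_def)
    show "c * (chart0 \<circ> p) z + d = (chart0 \<circ> ?q) z" if "z \<in> {z \<in> S. ?q z \<noteq> Infty}" for z
      using that by (cases "p z") auto
  qed
  moreover have "(chart1 \<circ> ?q) holomorphic_on ?A"
  proof (rule holomorphic_transform)
    have nz: "c * (chart0 \<circ> p) z + d \<noteq> 0" if "z \<in> ?A" for z
      using that by (cases "p z") auto
    have h: "(chart0 \<circ> p) holomorphic_on ?A"
      using h0 by (rule holomorphic_on_subset) auto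
    show "(\<lambda>z. inverse (c * (chart0 \<circ> p) z + d)) holomorphic_on ?A"
      by (intro holomorphic_on_inverse holomorphic_on_add holomorphic_on_mult
          holomorphic_on_const h nz)
    show "inverse (c * (chart0 \<circ> p) z + d) = (chart1 \<circ> ?q) z" if "z \<in> ?A" for z
      using that by (cases "p z") auto
  qed
  moreover have "(chart1 \<circ> ?q) holomorphic_on ?B"
  proof (rule holomorphic_transform)
    \<comment> \<open>At a finite value \<open>w\<close> the expression is
      \<open>(c w + d) / w\<close>; at \<open>Infty\<close> it is \<open>c\<close>.\<close>
    have nz: "c + d * (chart1 \<circ> p) z \<noteq> 0" if "z \<in> ?B" for z
      using that c by (cases "p z") (auto simp: field_simps)
    have h: "(chart1 \<circ> p) holomorphic_on ?B"
      using h1 by (rule holomorphic_on_subset) auto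
    show "(\<lambda>z. (chart1 \<circ> p) z / (c + d * (chart1 \<circ> p) z)) holomorphic_on ?B"
      by (intro holomorphic_on_divide holomorphic_on_add holomorphic_on_mult
          holomorphic_on_const h nz)
    show "(chart1 \<circ> p) z / (c + d * (chart1 \<circ> p) z) = (chart1 \<circ> ?q) z" if "z \<in> ?B" for z
      using that nz[OF that] by (cases "p z") (auto simp: field_simps)
  qed
  moreover have "open ?A" "open ?B"
    using op cp cq by blast+
  ultimately have chart0: "(chart0 \<circ> ?q) holomorphic_on {z \<in> S. ?q z \<noteq> Infty}"
    and "(chart1 \<circ> ?q) holomorphic_on (?A \<union> ?B)"
    by (simp_all only: holomorphic_on_Un)
  moreover have "{z \<in> S. ?q z \<noteq> Fin 0} = ?A \<union> ?B" by auto
  ultimately have "(chart1 \<circ> ?q) holomorphic_on {z \<in> S. ?q z \<noteq> Fin 0}" by simp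
  with cq chart0 show ?thesis
    unfolding sphere_holomorphic_on_def by blast
qed

lemma affine_map_inverse:
  assumes "c \<noteq> 0"
  shows "affine_map (inverse c) (- (d / c)) (affine_map c d s) = s"
    and "affine_map c d (affine_map (inverse c) (- (d / c)) s) = s"
  by (cases s; use assms in \<open>simp add: field_simps\<close>)+

lemma sphere_automorphism_affine_map:
  assumes "c \<noteq> 0"
  shows "sphere_automorphism (affine_map c d)"
proof -
  have "homeomorphism UNIV UNIV (affine_map c d) (affine_map (inverse c) (- (d / c)))"
    using assms by (intro homeomorphismI continuous_on_affine_map) (use assms in \<open>auto simp: affine_map_inverse\<close>)
  with assms show ?thesis
    unfolding sphere_automorphism_def
    by (intro exI[of _ "affine_map (inverse c) (- (d / c))"])
      (simp add: sphere_holomorphic_on_affine_map)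
qed

section \<open>Invariance of hyperbolic distances under automorphisms\<close>

lemma covering_space_compose_homeomorphism:
  assumes p: "covering_space c p S" and h: "homeomorphism S T f g"
  shows "covering_space c (f \<circ> p) T"
proof
  have cp: "continuous_on c p" "p ` c = S"
    using p by (auto simp: covering_space_def)
  show "continuous_on c (f \<circ> p)"
    using cp h by (metis continuous_on_compose homeomorphism_cont1)
  show "(f \<circ> p) ` c = T"
    using cp h by (metis image_comp homeomorphism_image1)
  fix x assume x: "x \<in> T"
  then have "g x \<in> S" using h by (auto simp: homeomorphism_def)
  then obtain W v where W: "g x \<in> W" "openin (top_of_set S) W" "\<Union>v = c \<inter> p -` W"
    "\<forall>u\<in>v. openin (top_of_set c) u" "pairwise disjnt v" "\<forall>u\<in>v. \<exists>q. homeomorphism u W p q"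
    using p unfolding covering_space_def by meson
  have WS: "W \<subseteq> S" using W(2) openin_imp_subset by blast
  have hW: "homeomorphism W (f ` W) f g"
    using homeomorphism_of_subsets[OF h WS] by blast
  show "\<exists>W. x \<in> W \<and> openin (top_of_set T) W \<and>
      (\<exists>v. \<Union>v = c \<inter> (f \<circ> p) -` W \<and> (\<forall>u\<in>v. openin (top_of_set c) u) \<and>
        pairwise disjnt v \<and> (\<forall>u\<in>v. \<exists>q. homeomorphism u W (f \<circ> p) q))"
  \<comment> \<open>An evenly covered neighbourhood of \<open>g x\<close> is pushed forward by
    \<open>f\<close>; the sheets above it stay the same.\<close>
  proof (intro exI[of _ "f ` W"] exI[of _ v] conjI)
    show "x \<in> f ` W" using W(1) x h by (force simp: homeomorphism_def)
    show "openin (top_of_set T) (f ` W)"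
      using h W(2) homeomorphism_imp_open_map by blast
    have "p z \<in> W \<longleftrightarrow> f (p z) \<in> f ` W" if "z \<in> c" for z
      using that cp(2) WS h unfolding homeomorphism_def by (metis image_iff image_eqI subset_eq)
    then show "\<Union>v = c \<inter> (f \<circ> p) -` (f ` W)" using W(3) by auto
    show "\<forall>u\<in>v. \<exists>q. homeomorphism u (f ` W) (f \<circ> p) q"
      using W(6) hW homeomorphism_compose by blast
  qed (use W in auto)
qed

lemma hyperbolic_dist_image_le:
  assumes "sphere_automorphism f"
  shows "hyperbolic_dist (f ` U) (f u) (f v) \<le> hyperbolic_dist U u v"
  unfolding hyperbolic_dist_def
proof (rule Inf_superset_mono, clarify)
  obtain g where g: "homeomorphism UNIV UNIV f g"
    "\<And>p S. open S \<Longrightarrow> sphere_holomorphic_on p S \<Longrightarrow> sphere_holomorphic_on (f \<circ> p) S"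
    using assms sphere_automorphismE by metis
  fix p z w assume *: "disk_covering p U" "z \<in> ball 0 1" "w \<in> ball 0 1" "u = p z" "v = p w"
  have "homeomorphism U (f ` U) f g"
    using homeomorphism_of_subsets[OF g(1)] by simp
  then have "disk_covering (f \<circ> p) (f ` U)"
    using *(1) g(2) covering_space_compose_homeomorphism unfolding disk_covering_def by blast
  then show "\<exists>q z' w'. disk_dist z w = disk_dist z' w' \<and> disk_covering q (f ` U) \<and>
      z' \<in> ball 0 1 \<and> w' \<in> ball 0 1 \<and> q z' = f (p z) \<and> q w' = f (p w)"
    using * by (metis o_apply)
qed

lemma hyperbolic_dist_image:
  assumes "sphere_automorphism f"
  shows "hyperbolic_dist (f ` U) (f u) (f v) = hyperbolic_dist U u v"
proof (rule antisym)
  obtain g where g: "homeomorphism UNIV UNIV f g" "sphere_automorphism g"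
    using assms sphere_automorphismE by metis
  then have [simp]: "g (f s) = s" for s by (simp add: homeomorphism_def)
  show "hyperbolic_dist U u v \<le> hyperbolic_dist (f ` U) (f u) (f v)"
    using hyperbolic_dist_image_le[OF g(2), of "f ` U" "f u" "f v"] by (simp add: image_image)
qed (rule hyperbolic_dist_image_le[OF assms])

text \<open>The nontrivial part of the gauge, with arbitrary marked points in place of -1 and 1, so
  that it can be transported by maps that move these points.\<close>

definition component_dist :: "riemann_sphere set \<Rightarrow> riemann_sphere \<Rightarrow> riemann_sphere \<Rightarrow> ennreal" where
  "component_dist S u v =
     (if connected_component (interior S) u v
      then hyperbolic_dist (connected_component_set (interior S) u) u v else \<infinity>)"

lemma component_dist_commute: "component_dist S u v = component_dist S v u"
proof (cases "connected_component (interior S) u v")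
  case True
  then have "connected_component_set (interior S) u = connected_component_set (interior S) v"
    by (simp add: connected_component_eq)
  moreover have "connected_component (interior S) v u"
    using True by (rule connected_component_sym)
  ultimately show ?thesis
    using True by (simp add: component_dist_def hyperbolic_dist_commute[of _ u v])
next
  case False
  then have "\<not> connected_component (interior S) v u"
    using connected_component_sym by blast
  with False show ?thesis by (simp add: component_dist_def)
qed

lemma interior_homeomorphism_image:
  fixes f :: "'a::topological_space \<Rightarrow> 'b::topological_space"
  assumes "homeomorphism UNIV UNIV f g"
  shows "interior (f ` S) = f ` interior S"
proof -
  have "open (f ` T)" if "open T" for T
    using homeomorphism_imp_open_map[OF assms, of T] that by simp
  moreover have "open (f -` T)" if "open T" for T
    using assms that by (simp add: homeomorphism_def continuous_on_open_vimage)
  moreover have inv: "g (f a) = a" "f (g b) = b" for a b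
    using assms by (auto simp: homeomorphism_def)
  ultimately show ?thesis
  proof (intro antisym)
    assume op: "\<And>T. open T \<Longrightarrow> open (f -` T)"
    have "f -` interior (f ` S) \<subseteq> interior S"
      using op interior_subset[of "f ` S"] inv
      by (intro interior_maximal) (auto, metis (no_types, opaque_lifting) image_iff subset_eq)
    then show "interior (f ` S) \<subseteq> f ` interior S"
      using inv by (metis image_iff subset_eq subsetI vimage_eq)
  next
    assume "\<And>T. open T \<Longrightarrow> open (f ` T)"
    then show "f ` interior S \<subseteq> interior (f ` S)"
      by (intro interior_maximal image_mono interior_subset) auto
  qed
qed

lemma component_dist_image:
  assumes "sphere_automorphism f"
  shows "component_dist (f ` S) (f u) (f v) = component_dist S u v"
proof -
  obtain g where g: "homeomorphism UNIV UNIV f g"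
    using assms sphere_automorphismE by metis
  have I: "interior (f ` S) = f ` interior S"
    by (rule interior_homeomorphism_image[OF g])
  have h: "homeomorphism (interior S) (f ` interior S) f g"
    using homeomorphism_of_subsets[OF g] by simp
  have inj: "f a = f b \<longleftrightarrow> a = b" for a b using g by (metis UNIV_I homeomorphism_apply1)
  show ?thesis
  proof (cases "u \<in> interior S \<and> v \<in> interior S")
    case True
    then show ?thesis
      using connected_component_homeomorphism_iff[OF h, of u v]
        connected_component_set_homeomorphism[OF h, of u] hyperbolic_dist_image[OF assms]
      by (simp add: component_dist_def I inj image_iff)
  next
    \<comment> \<open>Points outside the interior lie in no component, before or after applying
      \<open>f\<close>, so both sides are infinite.\<close>
    case False
    then have "\<not> connected_component (interior S) u v"
      "\<not> connected_component (f ` interior S) (f u) (f v)"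
      using connected_component_in by (metis, metis inj image_iff)
    then show ?thesis by (simp add: component_dist_def I)
  qed
qed


section \<open>The gauge\<close>

text \<open>This is \<open>\<lambda> \<mapsto> (1 + \<lambda>) / (1 - \<lambda>) = -1 - 2 / (\<lambda> - 1)\<close>.\<close>

definition cayley :: "riemann_sphere \<Rightarrow> riemann_sphere" where
  "cayley = affine_map (-2) (-1) \<circ> inversion \<circ> affine_map 1 (-1)"

lemma cayley_simps:
  "cayley Infty = Fin (-1)" "cayley (Fin 1) = Infty"
  "l \<noteq> 1 \<Longrightarrow> cayley (Fin l) = Fin ((1 + l) / (1 - l))"
  by (auto simp: cayley_def field_simps)

lemma sphere_automorphism_cayley: "sphere_automorphism cayley"
  unfolding cayley_def
  by (intro sphere_automorphism_compose sphere_automorphism_affine_map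
      sphere_automorphism_inversion) auto

context complex_tvs
begin

lemma cone_scale_iff:
  assumes "complex_cone C" "a \<noteq> 0"
  shows "scale a x \<in> C \<longleftrightarrow> x \<in> C"
proof -
  have *: "scale b y \<in> C" if "y \<in> C" for b y
    using assms(1) that unfolding complex_cone_def by blast
  from *[of "scale a x" "inverse a"] *[of x a] assms(2) show ?thesis by auto
qed

text \<open>In this asymmetric form, rescaling \<open>x\<close> only concerns its membership in a
  fixed line.\<close>

lemma lin_indep_iff: "lin_indep x y \<longleftrightarrow> y \<noteq> 0 \<and> x \<notin> span {y}"
  by (auto simp: lin_indep_def independent_insert dependent_single span_base)

lemma lin_indep_commute: "lin_indep x y \<longleftrightarrow> lin_indep y x"
  by (auto simp: lin_indep_def insert_commute)

lemma lin_indep_scale: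
  assumes "a \<noteq> 0"
  shows "lin_indep (scale a x) y \<longleftrightarrow> lin_indep x y"
proof -
  have "scale a x \<in> span {y} \<longleftrightarrow> x \<in> span {y}"
    using assms span_scale[of x "{y}" a] span_scale[of "scale a x" "{y}" "inverse a"] by auto
  then show ?thesis by (simp add: lin_indep_iff)
qed

lemma cone_gauge_eq:
  "cone_gauge C x y =
     (if lin_indep x y then component_dist (D C x y) (Fin (-1)) (Fin 1) else 0)"
  by (simp add: cone_gauge_def component_dist_def)

text \<open>For independent \<open>x\<close> and \<open>y\<close> this is the trace of the cone on
  the projective line of their span, in the coordinate \<open>t\<close> of the direction of
  \<open>t x + y\<close>; \<open>Infty\<close> stands for the direction of \<open>x\<close>.\<close>

definition cone_slice :: "'a set \<Rightarrow> 'a \<Rightarrow> 'a \<Rightarrow> riemann_sphere set" where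
  "cone_slice C x y = Fin ` {t. scale t x + y \<in> C} \<union> (if x \<in> C then {Infty} else {})"

text \<open>The vectors tested on the two sides differ by a nonzero factor, which the cone ignores:
  -1 at \<open>Infty\<close>, 2 at \<open>Fin 1\<close>, and \<open>1 - l\<close> at any other
  \<open>Fin l\<close>.\<close>

lemma D_eq_vimage_cone_slice:
  assumes "complex_cone C"
  shows "D C x y = cayley -` cone_slice C x y"
proof -
  have "s \<in> D C x y \<longleftrightarrow> cayley s \<in> cone_slice C x y" for s
  proof (cases s)
    case Infty
    have "x - y \<in> C \<longleftrightarrow> scale (-1) x + y \<in> C"
      using cone_scale_iff[OF assms, of "-1" "x - y"] by simp
    then show ?thesis by (auto simp: Infty D_def cone_slice_def cayley_simps)
  next
    case (Fin l)
    show ?thesis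
    proof (cases "l = 1")
      case True
      then show ?thesis
        using cone_scale_iff[OF assms, of 2 x] by (auto simp: Fin D_def cone_slice_def cayley_simps)
    next
      case False
      then have "scale (1 + l) x + scale (1 - l) y =
          scale (1 - l) (scale ((1 + l) / (1 - l)) x + y)"
        by (simp add: scale_right_distrib)
      with False cone_scale_iff[OF assms, of "1 - l"] show ?thesis
        by (auto simp: Fin D_def cone_slice_def cayley_simps)
    qed
  qed
  then show ?thesis by auto
qed

text \<open>The reason is \<open>t (a x) + y = (a t) x + y\<close>, together with invariance of the
  cone under \<open>a\<close> for the point \<open>Infty\<close>.\<close>

lemma cone_slice_scale:
  assumes "complex_cone C" "a \<noteq> 0"
  shows "cone_slice C (scale a x) y = affine_map a 0 -` cone_slice C x y"
proof -
  have "s \<in> cone_slice C (scale a x) y \<longleftrightarrow> affine_map a 0 s \<in> cone_slice C x y" for s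
    using cone_scale_iff[OF assms] by (cases s) (auto simp: cone_slice_def mult.commute)
  then show ?thesis by auto
qed

lemma cone_gauge_commute:
  assumes "complex_cone C"
  shows "cone_gauge C y x = cone_gauge C x y"
proof -
  let ?n = "affine_map (-1) 0"
  have nn: "?n (?n s) = s" for s by (cases s) auto
  have "x - y \<in> C \<longleftrightarrow> y - x \<in> C"
    using cone_scale_iff[OF assms, of "-1" "x - y"] by simp
  then have "s \<in> D C y x \<longleftrightarrow> ?n s \<in> D C x y" for s
    by (cases s) (auto simp: D_def add.commute)
  then have "D C y x = ?n ` D C x y"
    by (metis (no_types, lifting) nn image_iff subsetI subset_antisym)
  \<comment> \<open>The sign change also swaps the marked points;
    \<open>component_dist_commute\<close> restores their order afterwards.\<close>
  then have "component_dist (D C y x) (Fin 1) (Fin (-1)) =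
      component_dist (D C x y) (Fin (-1)) (Fin 1)"
    using component_dist_image[OF sphere_automorphism_affine_map[of "-1" 0],
        of "D C x y" "Fin (-1)" "Fin 1"] by simp
  then show ?thesis
    by (simp add: cone_gauge_eq lin_indep_commute[of y x] component_dist_commute[of "D C y x"])
qed

lemma cone_gauge_scale_left:
  assumes "complex_cone C" "a \<noteq> 0"
  shows "cone_gauge C (scale a x) y = cone_gauge C x y"
proof -
  \<comment> \<open>\<open>cayley\<close> moves the marked points -1 and 1 to 0 and
    \<open>Infty\<close>, the fixed points of multiplication by \<open>a\<close>.\<close>
  have "component_dist (D C u v) (Fin (-1)) (Fin 1) = component_dist (cone_slice C u v) (Fin 0) Infty" for u v
  proof -
    have "surj cayley"
      using sphere_automorphism_cayley by (metis homeomorphism_image1 sphere_automorphismE)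
    then have "cone_slice C u v = cayley ` D C u v"
      by (simp add: D_eq_vimage_cone_slice[OF assms(1)] surj_image_vimage_eq)
    then show ?thesis
      using component_dist_image[OF sphere_automorphism_cayley, of "D C u v" "Fin (-1)" "Fin 1"]
      by (simp add: cayley_simps)
  qed
  moreover have "component_dist (cone_slice C (scale a x) y) (Fin 0) Infty =
      component_dist (cone_slice C x y) (Fin 0) Infty"
  proof -
    have "surj (affine_map a 0)"
      using sphere_automorphism_affine_map[OF assms(2)]
      by (metis homeomorphism_image1 sphere_automorphismE)
    then have "cone_slice C x y = affine_map a 0 ` cone_slice C (scale a x) y"
      by (simp add: cone_slice_scale[OF assms] surj_image_vimage_eq)
    then show ?thesis
      using component_dist_image[OF sphere_automorphism_affine_map[OF assms(2)],
          of 0 "cone_slice C (scale a x) y" "Fin 0" Infty] by simp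
  qed
  ultimately show ?thesis using assms(2) by (simp add: cone_gauge_eq lin_indep_scale)
qed

end

theorem lemma2p3:
  fixes scale :: "complex \<Rightarrow> 'a::topological_ab_group_add \<Rightarrow> 'a"
    and C :: "'a set" and x y :: 'a and a :: complex
  assumes "complex_tvs scale"
    and "complex_tvs.complex_cone scale C"
    and "x \<in> C - {0}" and "y \<in> C - {0}" and "a \<noteq> 0"
  shows "complex_tvs.cone_gauge scale C y x = complex_tvs.cone_gauge scale C x y \<and>
         complex_tvs.cone_gauge scale C x y = complex_tvs.cone_gauge scale C (scale a x) y \<and>
         complex_tvs.cone_gauge scale C (scale a x) y = complex_tvs.cone_gauge scale C x (scale a y)"
proof -
  interpret complex_tvs scale by fact
  note cone = \<open>complex_cone C\<close>
  \<comment> \<open>Scaling the second argument reduces to scaling the first by applying symmetry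
    before and after.\<close>
  show ?thesis
    using cone_gauge_commute[OF cone] cone_gauge_scale_left[OF cone \<open>a \<noteq> 0\<close>] by metis
qed

end
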